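(* Let $\mathbb{X}$ be a real Banach space. Then $\mathbb{X}$ has the Ball Covering Property (BCP) if and only if there exists a countable set $\{x_i : i \in \mathbb{N}\} \subset \mathbb{X}\setminus\{0\}$ such that $\bigcap_{i\in\mathbb{N}} x_i^{\perp} = \{0\}$.
   Context: $S_{\mathbb{X}}$ is the unit sphere of $\mathbb{X}$ and $B(x,r)$ is the open ball with center $x$ and radius $r>0$. $\mathbb{X}$ has the Ball Covering Property (BCP) if $S_{\mathbb{X}}$ can be covered by countably many balls, none of which contains the origin; in other words, there is a sequence of balls $\{B(x_n,r_n)\}_{n=1}^{\infty}$ with $r_n\le\|x_n\|$ for each $n\in\mathbb{N}$ such that $S_{\mathbb{X}}\subseteq\bigcup_{n} B(x_n,r_n)$. Birkhoff-James orthogonality: $x\perp_B y$ means $\|x+\lambda y\|\ge\|x\|$ for all $\lambda\in\mathbb{R}$; $x^{\perp}:=\{y\in\mathbb{X}: x\perp_B y\}$. *)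

theory Defs
  imports "HOL-Analysis.Analysis"
begin

definition birkhoff_james_orthogonal :: "'a::real_normed_vector \<Rightarrow> 'a \<Rightarrow> bool"
    (infix "\<bottom>\<^sub>B" 50)
  where "x \<bottom>\<^sub>B y \<longleftrightarrow> (\<forall>t::real. norm (x + t *\<^sub>R y) \<ge> norm x)"

definition bj_orthogonal_set :: "'a::real_normed_vector \<Rightarrow> 'a set"
  where "bj_orthogonal_set x = {y. x \<bottom>\<^sub>B y}"

text \<open>
  The space is the whole type, passed as a type token. Balls have positive radius by convention;
  this matters only for the zero space, in which no such ball avoids the origin, so that the
  property fails there (just as no nonzero vectors exist there).
\<close>

definition ball_covering_property :: "'a::real_normed_vector itself \<Rightarrow> bool"
  where "ball_covering_property (_ :: 'a itself) \<longleftrightarrow>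
    (\<exists>(x :: nat \<Rightarrow> 'a) (r :: nat \<Rightarrow> real).
       (\<forall>n. 0 < r n \<and> r n \<le> norm (x n)) \<and>
       sphere 0 1 \<subseteq> (\<Union>n. ball (x n) (r n)))"

end

theory Submission
  imports Defs
begin

text \<open>
  A failure of \<open>x \<bottom>\<^sub>B y\<close> is an inequality \<open>norm (x + t *\<^sub>R y) < norm x\<close> with \<open>t \<noteq> 0\<close>. Dividing
  by \<open>t\<close> turns it into the statement that \<open>y\<close> lies in the ball about \<open>s *\<^sub>R x\<close>, where
  \<open>s = - 1 / t\<close>, whose radius is the norm of its centre, that is, in a largest ball about that
  centre that avoids the origin. Hence a vector that is not in the intersection of the sets
  \<open>bj_orthogonal_set (x i)\<close> is the same thing as a vector lying in such a ball with its centre on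
  one of the lines through \<open>0\<close> and \<open>x i\<close>. The balls of a covering of the sphere lie in such largest
  balls about their centres, so for these centres the intersection contains no unit vector and,
  being closed under scaling, only \<open>0\<close>.

  Conversely each line carries uncountably many such balls, but along a ray from the origin they
  increase, so those centred at the nonzero integer multiples of \<open>x i\<close> already have the same
  union (\<open>not_birkhoff_james_orthogonal_imp_in_integer_ball\<close>). Countably many lines then give
  countably many balls.
\<close>

text \<open>
  The two balls touch internally at the origin: \<open>norm (b *\<^sub>R x)\<close> is the sum of \<open>norm (a *\<^sub>R x)\<close> and
  the distance between the centres.
\<close>

lemma origin_avoiding_balls_increase_along_ray:
  fixes x :: "'a::real_normed_vector"
  assumes "0 \<le> a \<and> a \<le> b \<or> b \<le> a \<and> a \<le> 0"
  shows "ball (a *\<^sub>R x) (norm (a *\<^sub>R x)) \<subseteq> ball (b *\<^sub>R x) (norm (b *\<^sub>R x))"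
proof
  fix y assume y: "y \<in> ball (a *\<^sub>R x) (norm (a *\<^sub>R x))"
  have "dist (b *\<^sub>R x) (a *\<^sub>R x) = \<bar>b - a\<bar> * norm x"
    by (simp add: dist_norm flip: scaleR_diff_left)
  also have "\<dots> + norm (a *\<^sub>R x) = (\<bar>b - a\<bar> + \<bar>a\<bar>) * norm x"
    by (simp add: distrib_right)
  also have "\<bar>b - a\<bar> + \<bar>a\<bar> = \<bar>b\<bar>"
    using assms by auto
  finally have "dist (b *\<^sub>R x) (a *\<^sub>R x) + norm (a *\<^sub>R x) = norm (b *\<^sub>R x)"
    by simp
  with y show "y \<in> ball (b *\<^sub>R x) (norm (b *\<^sub>R x))"
    using dist_triangle[of "b *\<^sub>R x" y "a *\<^sub>R x"] by simp
qed

lemma not_birkhoff_james_orthogonal_imp_in_integer_ball: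
  fixes x y :: "'a::real_normed_vector"
  assumes "\<not> x \<bottom>\<^sub>B y"
  obtains k :: int where "k \<noteq> 0" "y \<in> ball (of_int k *\<^sub>R x) (norm (of_int k *\<^sub>R x))"
proof -
  obtain t where t: "norm (x + t *\<^sub>R y) < norm x"
    using assms by (auto simp: birkhoff_james_orthogonal_def not_le)
  then have "t \<noteq> 0"
    by auto
  define s where "s = - 1 / t"
  have "s \<noteq> 0"
    using \<open>t \<noteq> 0\<close> by (simp add: s_def)
  have "s *\<^sub>R x - y = s *\<^sub>R (x + t *\<^sub>R y)"
    using \<open>t \<noteq> 0\<close> by (simp add: s_def scaleR_add_right)
  then have "norm (s *\<^sub>R x - y) < norm (s *\<^sub>R x)"
    using t \<open>s \<noteq> 0\<close> by simp
  then have y: "y \<in> ball (s *\<^sub>R x) (norm (s *\<^sub>R x))"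
    by (simp add: dist_norm)
  \<comment> \<open>Rounding away from zero moves the centre outwards on its ray, so the ball can only grow.\<close>
  define k where "k = (if 0 < s then \<lceil>s\<rceil> else \<lfloor>s\<rfloor>)"
  have *: "0 \<le> s \<and> s \<le> of_int k \<or> of_int k \<le> s \<and> s \<le> 0"
    by (auto simp: k_def)
  then have "k \<noteq> 0"
    using \<open>s \<noteq> 0\<close> by auto
  with y show thesis
    using origin_avoiding_balls_increase_along_ray[OF *] that by blast
qed

theorem lemma1p2:
  "ball_covering_property TYPE('a::banach) \<longleftrightarrow>
    (\<exists>x :: nat \<Rightarrow> 'a. range x \<subseteq> UNIV - {0} \<and> (\<Inter>i. bj_orthogonal_set (x i)) = {0})"
proof
  assume "ball_covering_property TYPE('a)"
  then obtain x :: "nat \<Rightarrow> 'a" and r where r: "\<And>n. 0 < r n" "\<And>n. r n \<le> norm (x n)"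
    and cover: "sphere 0 1 \<subseteq> (\<Union>n. ball (x n) (r n))"
    unfolding ball_covering_property_def by blast
  have "x n \<noteq> 0" for n
    using r[of n] by auto
  moreover have "y = 0" if y: "\<And>n. x n \<bottom>\<^sub>B y" for y
  proof (rule ccontr)
    assume "y \<noteq> 0"
    then have "inverse (norm y) *\<^sub>R y \<in> sphere 0 1"
      by simp
    then obtain n where "inverse (norm y) *\<^sub>R y \<in> ball (x n) (r n)"
      using cover by blast
    then have "norm (x n - inverse (norm y) *\<^sub>R y) < r n"
      by (simp add: dist_norm)
    also have "r n \<le> norm (x n)"
      by (rule r)
    also have "\<dots> \<le> norm (x n + (- inverse (norm y)) *\<^sub>R y)"
      using y[of n] unfolding birkhoff_james_orthogonal_def by blast
    finally show False
      by simp
  qed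
  moreover have "x n \<bottom>\<^sub>B 0" for n
    by (simp add: birkhoff_james_orthogonal_def)
  ultimately show "\<exists>x :: nat \<Rightarrow> 'a. range x \<subseteq> UNIV - {0} \<and> (\<Inter>i. bj_orthogonal_set (x i)) = {0}"
    by (intro exI[of _ x]) (auto simp: bj_orthogonal_set_def)
next
  assume "\<exists>x :: nat \<Rightarrow> 'a. range x \<subseteq> UNIV - {0} \<and> (\<Inter>i. bj_orthogonal_set (x i)) = {0}"
  then obtain x :: "nat \<Rightarrow> 'a" where x: "\<And>n. x n \<noteq> 0"
    and inter: "(\<Inter>i. bj_orthogonal_set (x i)) = {0}"
    by blast
  define C where "C = (\<lambda>(i, k::int). of_int k *\<^sub>R x i) ` (UNIV \<times> - {0})"
  have "countable C"
    by (simp add: C_def)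
  have "(0, 1) \<in> (UNIV :: nat set) \<times> - {0 :: int}"
    by simp
  then have "C \<noteq> {}"
    unfolding C_def by blast
  with \<open>countable C\<close> have range: "range (from_nat_into C) = C"
    by (simp add: range_from_nat_into)
  have "0 \<notin> C"
    using x by (auto simp: C_def)
  then have "0 < norm (from_nat_into C n)" for n
    using range by (metis rangeI zero_less_norm_iff)
  moreover have "\<exists>n. y \<in> ball (from_nat_into C n) (norm (from_nat_into C n))"
    if "y \<in> sphere 0 1" for y
  proof -
    have "y \<notin> (\<Inter>i. bj_orthogonal_set (x i))"
      using that inter by auto
    then obtain i where "\<not> x i \<bottom>\<^sub>B y"
      by (auto simp: bj_orthogonal_set_def)
    then obtain k :: int
      where "k \<noteq> 0" and y: "y \<in> ball (of_int k *\<^sub>R x i) (norm (of_int k *\<^sub>R x i))"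
      by (rule not_birkhoff_james_orthogonal_imp_in_integer_ball)
    then have "of_int k *\<^sub>R x i \<in> C"
      by (force simp: C_def)
    then obtain n where "of_int k *\<^sub>R x i = from_nat_into C n"
      using range by blast
    with y show ?thesis
      by metis
  qed
  ultimately show "ball_covering_property TYPE('a)"
    unfolding ball_covering_property_def
    by (intro exI[of _ "from_nat_into C"] exI[of _ "\<lambda>n. norm (from_nat_into C n)"]) blast
qed

end
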